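(* Let $G=([n],E)$ be a connected undirected graph, and suppose $\alpha\notin\mathbb{Q}$ is an eigenvalue of the Laplacian of $G$ with eigenspace $\Lambda$ of dimension $m$. Let $P(x)$ be the minimal polynomial of $\alpha$ over $\mathbb{Q}$, and let $\alpha'$ be a conjugate of $\alpha$, i.e. another root of $P(x)$. Then $\alpha'$ is also an eigenvalue of the Laplacian of $G$, its eigenspace $\Lambda'$ has dimension $m=\dim(\Lambda)$, and any subset $W\subset[n]$ with rational weights $a_w\in\mathbb{Q}$ ($w\in W$) that averages $\Lambda$ also averages $\Lambda'$.
   Context: $[n]=\{1,\dots,n\}$. The Laplacian $L$ of $G$ is the $n\times n$ matrix with $L_{ii}=\deg(i)$, $L_{ij}=-1$ if $\{i,j\}\in E$, and $L_{ij}=0$ otherwise. Eigenspaces are real subspaces of $\mathbb{R}^n$, whose elements are viewed as functions $[n]\to\mathbb{R}$. A subset $W\subset[n]$ with weights $a_w$ averages a function $f:[n]\to\mathbb{R}$ if $\frac1n\sum_{v\in[n]}f(v)=\sum_{w\in W}a_wf(w)$, and averages a subspace of functions if it averages every function in it. *)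

theory Defs
  imports "HOL-Analysis.Analysis" "HOL-Computational_Algebra.Polynomial"
begin

text \<open>The vertex set \<open>[n]\<close> is the universe of a finite type, so \<open>n = CARD('n)\<close>. A graph is given
  by its set of edges, each edge being an unordered pair of distinct vertices.\<close>

definition simple_graph :: "'n::finite set set \<Rightarrow> bool" where
  "simple_graph E \<longleftrightarrow> (\<forall>e\<in>E. card e = 2)"

definition connected_graph :: "'n::finite set set \<Rightarrow> bool" where
  "connected_graph E \<longleftrightarrow> (\<forall>u v. (u, v) \<in> {(x, y). {x, y} \<in> E}\<^sup>*)"

definition deg :: "'n::finite set set \<Rightarrow> 'n \<Rightarrow> nat" where
  "deg E i = card {e \<in> E. i \<in> e}"

definition laplacian :: "'n::finite set set \<Rightarrow> real^'n^'n" where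
  "laplacian E = (\<chi> i j. if i = j then real (deg E i) else if {i, j} \<in> E then -1 else 0)"

definition eigenspace :: "real^'n^'n \<Rightarrow> real \<Rightarrow> (real^'n) set" where
  "eigenspace A c = {f. A *v f = c *\<^sub>R f}"

definition is_eigenvalue :: "real^'n^'n \<Rightarrow> real \<Rightarrow> bool" where
  "is_eigenvalue A c \<longleftrightarrow> (\<exists>f. f \<noteq> 0 \<and> A *v f = c *\<^sub>R f)"

definition is_minimal_polynomial :: "rat poly \<Rightarrow> 'a::field_char_0 \<Rightarrow> bool" where
  "is_minimal_polynomial P x \<longleftrightarrow>
     lead_coeff P = 1 \<and> poly (map_poly of_rat P) x = 0 \<and>
     (\<forall>Q. Q \<noteq> 0 \<and> poly (map_poly of_rat Q) x = 0 \<longrightarrow> degree P \<le> degree Q)"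

definition averages :: "'n::finite set \<Rightarrow> ('n \<Rightarrow> real) \<Rightarrow> real^'n \<Rightarrow> bool" where
  "averages W a f \<longleftrightarrow>
     (1 / real CARD('n)) * (\<Sum>v\<in>UNIV. f $ v) = (\<Sum>w\<in>W. a w * f $ w)"

definition averages_space :: "'n::finite set \<Rightarrow> ('n \<Rightarrow> real) \<Rightarrow> (real^'n) set \<Rightarrow> bool" where
  "averages_space W a U \<longleftrightarrow> (\<forall>f\<in>U. averages W a f)"

end

theory Submission
  imports Defs "HOL-Computational_Algebra.Polynomial_Factorial" "HOL-Computational_Algebra.Field_as_Ring"
begin

text \<open>Let \<open>A\<close> be the Laplacian as a rational matrix and \<open>M\<close> its rational annihilating polynomial of
  least degree. Symmetry of \<open>A\<close> makes the roots of \<open>M\<close> simple, so for every root \<open>y\<close> the matrix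
  \<open>H(y) = (M(x) / (x - y))(A)\<close> is \<open>M'(y)\<close> times the orthogonal projection onto the eigenspace
  of \<open>y\<close>. The entries of \<open>H(y)\<close> are rational polynomials in \<open>y\<close>, and so are its trace, which is
  \<open>M'(y)\<close> times the dimension of the eigenspace, and the averaging defects of its columns, which
  span the eigenspace. A rational polynomial vanishing at \<open>\<alpha>\<close> vanishes at every conjugate, so both
  properties carry over. The trace at a conjugate is nonzero, which makes the conjugate an
  eigenvalue of a real symmetric matrix, hence real.\<close>

section \<open>Ring homomorphisms acting on polynomial coefficients\<close>

text \<open>The instances are scalar embeddings, \<open>a\<close> to \<open>[:a:]\<close>, and
  evaluation of rational polynomials at a point. One transport lemma for matrix polynomials then
  serves all of them.\<close>

locale comm_ring_1_hom =
  fixes h :: "'a::comm_ring_1 \<Rightarrow> 'b::comm_ring_1"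
  assumes hom_add: "h (x + y) = h x + h y"
    and hom_mult: "h (x * y) = h x * h y"
    and hom_1: "h 1 = 1"
begin

lemma hom_0: "h 0 = 0"
  using hom_add[of 0 0] by simp

lemma hom_sum: "h (sum f S) = (\<Sum>x\<in>S. h (f x))"
  by (induction S rule: infinite_finite_induct) (simp_all add: hom_0 hom_add)

lemma hom_of_nat: "h (of_nat k) = of_nat k"
  by (induction k) (simp_all add: hom_0 hom_1 hom_add)

lemma map_poly_add: "map_poly h (p + q) = map_poly h p + map_poly h q"
  by (intro poly_eqI) (simp add: coeff_map_poly hom_0 hom_add)

lemma map_poly_mult: "map_poly h (p * q) = map_poly h p * map_poly h q"
  by (intro poly_eqI) (simp add: coeff_map_poly coeff_mult hom_0 hom_sum hom_mult)

lemma poly_map_poly: "poly (map_poly h p) (h x) = h (poly p x)"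
  by (induction p) (simp_all add: map_poly_pCons hom_0 hom_add hom_mult)

lemma comm_ring_1_hom_poly: "comm_ring_1_hom (\<lambda>p. poly (map_poly h p) x)"
  by unfold_locales (simp_all add: map_poly_add map_poly_mult map_poly_1 hom_1)

lemma map_poly_synthetic_div:
  "map_poly h (synthetic_div p c) = synthetic_div (map_poly h p) (h c)"
  by (induction p) (simp_all add: map_poly_pCons hom_0 poly_map_poly)

end

lemma pderiv_map_poly:
  fixes h :: "'a::idom \<Rightarrow> 'b::idom"
  assumes "comm_ring_1_hom h"
  shows "pderiv (map_poly h p) = map_poly h (pderiv p)"
proof -
  interpret comm_ring_1_hom h by fact
  show ?thesis
    by (induction p) (simp_all add: map_poly_pCons hom_0 pderiv_pCons map_poly_add)
qed

interpretation of_rat: comm_ring_1_hom "of_rat :: rat \<Rightarrow> 'a::field_char_0"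
  by unfold_locales (simp_all add: of_rat_add of_rat_mult)

interpretation of_real: comm_ring_1_hom "of_real :: real \<Rightarrow> complex"
  by unfold_locales simp_all

interpretation const_poly: comm_ring_1_hom "\<lambda>a. [:a:] :: 'a::comm_ring_1 poly"
  by unfold_locales simp_all

interpretation rat_eval: comm_ring_1_hom "\<lambda>p. poly (map_poly of_rat p) (x::'a::field_char_0)" for x
  by (rule of_rat.comm_ring_1_hom_poly)

lemma of_real_of_rat: "of_real (of_rat q) = (of_rat q :: 'a::{real_div_algebra,field_char_0})"
proof (cases q)
  case (Fract a b)
  then show ?thesis by (simp add: of_rat_rat)
qed

section \<open>Polynomials evaluated at a matrix\<close>

definition map_matrix :: "('a \<Rightarrow> 'b) \<Rightarrow> 'a^'n^'m \<Rightarrow> 'b^'n^'m"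
  where "map_matrix f A = (\<chi> i j. f (A $ i $ j))"

lemma map_matrix_nth [simp]: "map_matrix f A $ i $ j = f (A $ i $ j)"
  by (simp add: map_matrix_def)

lemma map_matrix_map_matrix: "map_matrix f (map_matrix g A) = map_matrix (\<lambda>x. f (g x)) A"
  by (simp add: vec_eq_iff)

lemma mat_add: "mat (a + b) = mat a + mat b" for a :: "'a::monoid_add"
  by (simp add: vec_eq_iff mat_def)

lemma mat_matrix_mult_nth: "(mat c ** A) $ i $ j = c * A $ i $ j"
  for A :: "'a::comm_ring_1^'n^'n"
  by (simp add: matrix_matrix_mult_def mat_def if_distrib[where f = "\<lambda>x. x * _"] cong: if_cong)

lemma mat_matrix_mult_comm: "A ** mat c = mat c ** A"
  for A :: "'a::comm_ring_1^'n^'n"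
  by (simp add: matrix_matrix_mult_def mat_def vec_eq_iff if_distrib[where f = "\<lambda>x. x * _"]
      if_distrib[where f = "\<lambda>x. _ * x"] mult.commute cong: if_cong)

lemma mat_matrix_vector_mult: "mat c *v v = c *s v"
  for v :: "'a::comm_ring_1^'n"
  by (simp add: matrix_vector_mult_def mat_def vec_eq_iff if_distrib[where f = "\<lambda>x. x * _"]
      cong: if_cong)

lemma matrix_add_rdistrib: "(A + B) ** C = A ** C + B ** C"
  for A B :: "'a::comm_ring_1^'n^'m"
  by (simp add: matrix_matrix_mult_def vec_eq_iff distrib_right sum.distrib)

definition matrix_poly :: "'a::comm_ring_1 poly \<Rightarrow> 'a^'n^'n \<Rightarrow> 'a^'n^'n"
  where "matrix_poly p A = fold_coeffs (\<lambda>a B. mat a + A ** B) p 0"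

lemma matrix_poly_0 [simp]: "matrix_poly 0 A = 0"
  by (simp add: matrix_poly_def)

lemma matrix_poly_pCons [simp]: "matrix_poly (pCons a p) A = mat a + A ** matrix_poly p A"
  by (cases "a = 0 \<and> p = 0") (auto simp: matrix_poly_def)

lemma matrix_poly_add: "matrix_poly (p + q) A = matrix_poly p A + matrix_poly q A"
proof (induction p arbitrary: q)
  case (pCons a p)
  then show ?case
    by (cases q) (simp add: mat_add matrix_add_ldistrib)
qed simp

lemma matrix_poly_smult: "matrix_poly (smult c p) A = mat c ** matrix_poly p A"
proof (induction p)
  case (pCons a p)
  have "mat (c * a) = mat c ** (mat a :: 'a^'n^'n)"
    unfolding vec_eq_iff mat_matrix_mult_nth by (simp add: mat_def)
  moreover have "A ** (mat c ** matrix_poly p A) = mat c ** (A ** matrix_poly p A)"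
    by (metis mat_matrix_mult_comm matrix_mul_assoc)
  ultimately show ?case
    using pCons by (simp add: matrix_add_ldistrib)
qed simp

lemma matrix_poly_mult: "matrix_poly (p * q) A = matrix_poly p A ** matrix_poly q A"
  by (induction p)
    (simp_all add: matrix_poly_add matrix_poly_smult matrix_add_rdistrib matrix_mul_assoc)

text \<open>Both sides are the value at \<open>A\<close> of the same product of \<open>p\<close>
  with the indeterminate.\<close>

lemma matrix_poly_commute: "A ** matrix_poly p A = matrix_poly p A ** A"
  using matrix_poly_mult[of "[:0, 1:]" p A] matrix_poly_mult[of p "[:0, 1:]" A]
  by (simp add: mult.commute del: mult_pCons_left mult_pCons_right)

lemma transpose_add: "transpose (A + B) = transpose A + transpose B"
  by (simp add: transpose_def vec_eq_iff)

lemma transpose_zero: "transpose 0 = 0"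
  by (simp add: transpose_def vec_eq_iff)

lemma transpose_matrix_poly:
  assumes "transpose A = A"
  shows "transpose (matrix_poly p A) = matrix_poly p A"
  by (induction p)
    (simp_all add: transpose_zero transpose_add matrix_transpose_mul assms matrix_poly_commute)

lemma matrix_poly_eigenvector:
  assumes "A *v f = c *s f"
  shows "matrix_poly p A *v f = poly p c *s f"
proof (induction p)
  case (pCons a p)
  have "A *v (poly p c *s f) = poly p c *s (A *v f)"
    by (simp add: matrix_vector_mult_def vec_eq_iff sum_distrib_left mult.left_commute)
  with pCons show ?case
    by (simp add: matrix_vector_mult_add_rdistrib mat_matrix_vector_mult assms
        flip: matrix_vector_mul_assoc)
      (simp add: vec_eq_iff algebra_simps)
qed simp

lemma (in comm_ring_1_hom) map_matrix_matrix_poly: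
  "map_matrix h (matrix_poly p A) = matrix_poly (map_poly h p) (map_matrix h A)"
proof (induction p)
  case 0
  then show ?case by (simp add: vec_eq_iff hom_0)
next
  case (pCons a p)
  have "map_matrix h (A ** matrix_poly p A) = map_matrix h A ** map_matrix h (matrix_poly p A)"
    by (simp add: vec_eq_iff matrix_matrix_mult_def hom_sum hom_mult)
  moreover have "map_matrix h (mat a) = (mat (h a) :: 'b^'c^'c)"
    by (simp add: vec_eq_iff mat_def hom_0)
  moreover have "map_matrix h (X + Y) = map_matrix h X + map_matrix h Y" for X Y :: "'a^'c^'c"
    by (simp add: vec_eq_iff hom_add)
  ultimately show ?case
    using pCons by (simp add: map_poly_pCons hom_0)
qed

section \<open>Symmetric matrices and annihilating polynomials\<close>

text \<open>With \<open>X = B ** C\<close>, symmetry gives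
  \<open>transpose X ** X = transpose C ** (B ** (B ** C))\<close>, whose diagonal consists of the
  sums of squares of the columns of \<open>X\<close>. Only an ordered ring is required, so this
  applies to rational matrices; it is the source of simple roots.\<close>

lemma symmetric_square_eq_0:
  fixes B :: "'a::linordered_idom^'n^'n"
  assumes "transpose B = B" and "B ** (B ** C) = 0"
  shows "B ** C = 0"
proof -
  define X where "X = B ** C"
  have "transpose X ** X = transpose C ** (B ** (B ** C))"
    by (simp add: X_def matrix_transpose_mul assms(1) matrix_mul_assoc)
  then have "transpose X ** X = 0"
    using assms(2) by simp
  then have "(transpose X ** X) $ j $ j = 0" for j
    by simp
  then have "(\<Sum>i\<in>UNIV. X $ i $ j * X $ i $ j) = 0" for j
    by (simp add: matrix_matrix_mult_def transpose_def)
  then have "X $ i $ j = 0" for i j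
    by (simp add: sum_nonneg_eq_0_iff)
  then show ?thesis
    by (simp add: X_def vec_eq_iff)
qed

lemma annihilating_poly_exists:
  fixes A :: "'a::field^'n^'n"
  shows "\<exists>p. p \<noteq> 0 \<and> matrix_poly p A = 0"
proof -
  \<comment> \<open>Matrices are flattened to vectors indexed by pairs, so that the dimension theory
    of \<open>vec\<close> applies to the powers of \<open>A\<close>.\<close>
  define F :: "nat \<Rightarrow> 'a^('n \<times> 'n)"
    where "F k = (\<chi> x. matrix_poly (monom 1 k) A $ fst x $ snd x)" for k
  define N where "N = vec.dim (UNIV :: ('a^('n \<times> 'n)) set)"
  show ?thesis
  \<comment> \<open>Linear dependence is a property of sets, so a repeated power is treated
    separately. It directly yields a difference of two monomials; otherwise \<open>N + 1\<close>
    distinct vectors exceed the dimension.\<close>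
  proof (cases "inj_on F {..N}")
    case False
    then obtain i j where ij: "i \<noteq> j" "F i = F j"
      by (auto simp: inj_on_def)
    have "matrix_poly (monom 1 i) A = matrix_poly (monom 1 j) A"
      using ij(2) by (simp add: F_def vec_eq_iff)
    then have "matrix_poly (monom 1 i + smult (-1) (monom 1 j)) A = 0"
      unfolding matrix_poly_add matrix_poly_smult by (simp add: vec_eq_iff mat_matrix_mult_nth)
    moreover have "coeff (monom (1::'a) i + smult (-1) (monom 1 j)) i = 1"
      using ij(1) by simp
    then have "monom (1::'a) i + smult (-1) (monom 1 j) \<noteq> 0"
      by (metis coeff_0 zero_neq_one)
    ultimately show ?thesis by blast
  next
    case True
    have "vec.dim (F ` {..N}) \<le> N"
      unfolding N_def by (rule vec.dim_subset) simp
    then have "vec.dependent (F ` {..N})"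
      using True by (intro vec.dependent_biggerset_general) (simp add: card_image)
    then obtain u v where uv: "v \<in> F ` {..N}" "u v \<noteq> 0" "(\<Sum>v\<in>F ` {..N}. u v *s v) = 0"
      by (auto simp: vec.dependent_finite)
    define p where "p = (\<Sum>k\<le>N. monom (u (F k)) k)"
    obtain k where k: "k \<le> N" "v = F k" using uv(1) by auto
    have "coeff p k = u (F k)"
      using k(1) by (simp add: p_def coeff_sum if_distrib cong: if_cong)
    then have "p \<noteq> 0" using uv(2) k(2) by auto
    moreover have "matrix_poly (sum g S) A = (\<Sum>k\<in>S. matrix_poly (g k) A)"
      for g and S :: "nat set"
      by (induction S rule: infinite_finite_induct) (simp_all add: matrix_poly_add)
    then have "matrix_poly p A = (\<Sum>k\<le>N. mat (u (F k)) ** matrix_poly (monom 1 k) A)"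
      unfolding p_def by (simp add: smult_monom flip: matrix_poly_smult)
    then have "matrix_poly p A $ i $ j = (\<Sum>k\<le>N. u (F k) *s F k) $ (i, j)" for i j
      by (simp add: F_def mat_matrix_mult_nth)
    then have "matrix_poly p A = 0"
      using uv(3) True by (simp add: sum.reindex vec_eq_iff)
    ultimately show ?thesis by blast
  qed
qed

text \<open>The hypotheses force \<open>H\<close> to be \<open>\<mu>\<close> times the orthogonal
  projection onto \<open>S\<close>. In an orthonormal basis \<open>B\<close> the diagonal entry at
  \<open>j\<close> is \<open>\<mu>\<close> times the sum of the squared \<open>j\<close>-th
  coordinates; summing over \<open>j\<close> first gives 1 for each basis vector.\<close>

lemma trace_eq_dim:
  fixes H :: "real^'n^'n"
  assumes "subspace S" and "transpose H = H"
    and range: "\<And>v. H *v v \<in> S" and scale: "\<And>v. v \<in> S \<Longrightarrow> H *v v = \<mu> *\<^sub>R v"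
  shows "trace H = \<mu> * real (dim S)"
proof -
  obtain B where B: "B \<subseteq> S" "pairwise orthogonal B" "\<And>x. x \<in> B \<Longrightarrow> norm x = 1"
    "independent B" "card B = dim S" "span B = S"
    using orthonormal_basis_subspace[OF assms(1)] by metis
  have "finite B"
    using B(4) by (simp add: independent_bound)
  \<comment> \<open>Expansion in an orthonormal basis: the remainder \<open>w\<close> lies in the
    span of \<open>B\<close> and is orthogonal to \<open>B\<close>, hence to itself.\<close>
  have expand: "v = (\<Sum>b\<in>B. (v \<bullet> b) *\<^sub>R b)" if "v \<in> S" for v
  proof -
    define w where "w = v - (\<Sum>b\<in>B. (v \<bullet> b) *\<^sub>R b)"
    have orth: "w \<bullet> b = 0" if "b \<in> B" for b
    proof -
      have "(\<Sum>c\<in>B. (v \<bullet> c) * (c \<bullet> b)) = (\<Sum>c\<in>B. if c = b then v \<bullet> b else 0)"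
        using B(2,3) that by (intro sum.cong) (auto simp: pairwise_def orthogonal_def norm_eq_1)
      then show ?thesis
        using that \<open>finite B\<close> by (simp add: w_def inner_diff_left inner_sum_left)
    qed
    have "w \<in> span B"
      unfolding w_def using that B(6) by (intro span_diff span_sum span_scale) (auto intro: span_base)
    then have "orthogonal w w"
      by (rule orthogonal_to_span) (simp add: orthogonal_def orth)
    then show ?thesis
      by (simp add: orthogonal_self w_def)
  qed
  have "H $ j $ j = \<mu> * (\<Sum>b\<in>B. (b $ j)\<^sup>2)" for j
  proof -
    have "(H *v axis j 1) \<bullet> b = \<mu> * b $ j" if "b \<in> B" for b
    proof -
      have "(H *v axis j 1) \<bullet> b = axis j 1 \<bullet> (H *v b)"
        by (metis assms(2) dot_lmul_matrix vector_transpose_matrix)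
      then show ?thesis
        using scale B(1) that by (auto simp: inner_axis')
    qed
    then have "H *v axis j 1 = (\<Sum>b\<in>B. (\<mu> * b $ j) *\<^sub>R b)"
      using expand[OF range[of "axis j 1"]] by simp
    then have "(H *v axis j 1) $ j = \<mu> * (\<Sum>b\<in>B. (b $ j)\<^sup>2)"
      by (simp add: sum_distrib_left power2_eq_square mult.assoc)
    then show ?thesis
      by (simp add: matrix_vector_mult_basis column_def)
  qed
  then have "trace H = \<mu> * (\<Sum>b\<in>B. \<Sum>j\<in>UNIV. (b $ j)\<^sup>2)"
    unfolding trace_def by (subst sum.swap) (simp add: sum_distrib_left)
  also have "(\<Sum>b\<in>B. \<Sum>j\<in>UNIV. (b $ j)\<^sup>2) = (\<Sum>b\<in>B. 1)"
    using B(3) by (intro sum.cong) (auto simp: norm_eq_1 inner_vec_def power2_eq_square)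
  finally show ?thesis
    using B(5) by simp
qed

text \<open>The Hermitian form of \<open>A\<close> at \<open>v\<close> equals \<open>c * S\<close>,
  where \<open>S\<close> is the positive real squared norm of \<open>v\<close>. Conjugating the form
  only swaps its two summation indices.\<close>

lemma symmetric_eigenvalue_real:
  fixes A :: "real^'n^'n" and v :: "complex^'n"
  assumes "transpose A = A" and "map_matrix of_real A *v v = c *s v" and "v \<noteq> 0"
  shows "c \<in> \<real>"
proof -
  define S where "S = (\<Sum>i\<in>UNIV. cnj (v $ i) * v $ i)"
  have "(\<Sum>i\<in>UNIV. cnj (v $ i) * (map_matrix of_real A *v v) $ i) = c * S"
    unfolding assms(2) by (simp add: S_def sum_distrib_left mult_ac)
  then have cS: "c * S = (\<Sum>i\<in>UNIV. \<Sum>j\<in>UNIV. cnj (v $ i) * (of_real (A $ i $ j) * v $ j))"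
    by (simp add: matrix_vector_mult_def sum_distrib_left)
  have sym: "A $ i $ j = A $ j $ i" for i j
    using assms(1) by (metis transpose_def vec_lambda_beta)
  have "cnj (c * S) = c * S"
    unfolding cS by (simp, subst sum.swap, intro sum.cong refl) (simp add: sym mult_ac)
  moreover have S: "S = of_real (\<Sum>i\<in>UNIV. (cmod (v $ i))\<^sup>2)"
    by (simp add: S_def mult.commute flip: complex_norm_square)
  have "S \<noteq> 0"
    using assms(3) unfolding S of_real_eq_0_iff by (simp add: sum_nonneg_eq_0_iff vec_eq_iff)
  ultimately have "cnj c = c"
    by (simp add: S)
  then show ?thesis
    by (simp add: Reals_cnj_iff)
qed


section \<open>Minimal polynomials and conjugates\<close>

lemma minimal_polynomial_dvd:
  assumes "is_minimal_polynomial P x" and "poly (map_poly of_rat Q) x = 0"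
  shows "P dvd Q"
proof (rule ccontr)
  assume "\<not> P dvd Q"
  then have nz: "Q mod P \<noteq> 0" by (simp add: dvd_eq_mod_eq_0)
  have P: "P \<noteq> 0" "poly (map_poly of_rat P) x = 0"
    using assms(1) by (auto simp: is_minimal_polynomial_def)
  have "poly (map_poly of_rat (P * (Q div P) + Q mod P)) x = 0"
    using assms(2) by simp
  then have "poly (map_poly of_rat (Q mod P)) x = 0"
    unfolding rat_eval.hom_add rat_eval.hom_mult using P(2) by simp
  then have "degree P \<le> degree (Q mod P)"
    using assms(1) nz by (auto simp: is_minimal_polynomial_def)
  then show False
    using degree_mod_less[of P Q] P(1) nz by simp
qed

text \<open>The right-hand side is independent of \<open>x\<close>. Hence vanishing and nonvanishing
  of a rational polynomial both pass between numbers with the same minimal polynomial, even in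
  different fields.\<close>

lemma minimal_polynomial_eval_0_iff:
  assumes "is_minimal_polynomial P x"
  shows "poly (map_poly of_rat Q) x = 0 \<longleftrightarrow> P dvd Q"
  using assms minimal_polynomial_dvd
  by (auto simp: is_minimal_polynomial_def rat_eval.hom_mult)

text \<open>If some \<open>Q\<close> of smaller degree vanished at \<open>y\<close>, then by Bezout
  so would \<open>gcd P Q\<close>, which would thus be a nonconstant proper factor of
  \<open>P\<close>. It and its cofactor have degree below that of \<open>P\<close>, so neither
  vanishes at \<open>x\<close>, contradicting that \<open>P\<close> does.\<close>

lemma minimal_polynomial_conjugate:
  fixes x :: "'a::field_char_0" and y :: "'b::field_char_0"
  assumes "is_minimal_polynomial P x" and "poly (map_poly of_rat P) y = 0"
  shows "is_minimal_polynomial P y"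
  unfolding is_minimal_polynomial_def
proof (intro conjI allI impI)
  show "lead_coeff P = 1"
    using assms(1) by (simp add: is_minimal_polynomial_def)
  show "poly (map_poly of_rat P) y = 0" by fact
  fix Q :: "rat poly"
  assume Q: "Q \<noteq> 0 \<and> poly (map_poly of_rat Q) y = 0"
  show "degree P \<le> degree Q"
  proof (rule ccontr)
    assume "\<not> degree P \<le> degree Q"
    define G where "G = gcd P Q"
    have min: "degree P \<le> degree R" if "R \<noteq> 0" "poly (map_poly of_rat R) x = 0" for R
      using assms(1) that by (auto simp: is_minimal_polynomial_def)
    obtain a b where "a * P + b * Q = G"
      using bezout_coefficients_fst_snd[of P Q] unfolding G_def by blast
    then have Gy: "poly (map_poly of_rat G) y = 0"
      using Q assms(2) by (auto simp: rat_eval.hom_add rat_eval.hom_mult simp flip: \<open>a * P + b * Q = G\<close>)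
    obtain H where H: "P = G * H" unfolding G_def by (metis dvdE gcd_dvd1)
    have "P \<noteq> 0" using assms(1) by (auto simp: is_minimal_polynomial_def)
    then have nz: "G \<noteq> 0" "H \<noteq> 0" using H by auto
    have "degree G \<le> degree Q"
      using Q unfolding G_def by (intro dvd_imp_degree_le) auto
    then have "poly (map_poly of_rat G) x \<noteq> 0"
      using min[of G] nz \<open>\<not> degree P \<le> degree Q\<close> by auto
    moreover have "degree G \<noteq> 0"
    proof
      assume "degree G = 0"
      then obtain c where "G = [:c:]" by (metis degree_eq_zeroE)
      then show False using Gy nz(1) by (simp add: map_poly_pCons)
    qed
    then have "poly (map_poly of_rat H) x \<noteq> 0"
      using min[of H] nz by (auto simp: H degree_mult_eq)
    ultimately show False
      using assms(1) by (simp add: is_minimal_polynomial_def H rat_eval.hom_mult)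
  qed
qed

text \<open>In characteristic 0 the derivative of a nonconstant polynomial is nonzero and of smaller
  degree, so minimality excludes it.\<close>

lemma pderiv_minimal_polynomial_nonzero:
  fixes x :: "'a::field_char_0"
  assumes "is_minimal_polynomial P x"
  shows "poly (map_poly of_rat (pderiv P)) x \<noteq> 0"
proof
  assume *: "poly (map_poly of_rat (pderiv P)) x = 0"
  have P: "lead_coeff P = 1" "poly (map_poly of_rat P) x = 0"
    using assms by (auto simp: is_minimal_polynomial_def)
  have "degree P \<noteq> 0"
  proof
    assume "degree P = 0"
    then obtain c where "P = [:c:]" by (metis degree_eq_zeroE)
    then show False using P by (simp add: map_poly_pCons)
  qed
  then have "pderiv P \<noteq> 0" "degree (pderiv P) < degree P"
    by (auto simp: pderiv_eq_0_iff degree_pderiv)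
  then show False
    using assms * by (fastforce simp: is_minimal_polynomial_def)
qed

lemma pderiv_annihilator_nonzero:
  fixes x :: "'a::field_char_0" and A :: "rat^'n^'n"
  assumes "is_minimal_polynomial P x" and "transpose A = A"
    and "M \<noteq> 0" and "matrix_poly M A = 0"
    and least: "\<And>N. N \<noteq> 0 \<Longrightarrow> matrix_poly N A = 0 \<Longrightarrow> degree M \<le> degree N"
    and root: "poly (map_poly of_rat M) x = 0"
  shows "poly (map_poly of_rat (pderiv M)) x \<noteq> 0"
proof
  assume *: "poly (map_poly of_rat (pderiv M)) x = 0"
  obtain N where N: "M = P * N"
    using minimal_polynomial_dvd[OF assms(1) root] by (rule dvdE)
  have "poly (map_poly of_rat P) x = 0"
    using assms(1) by (simp add: is_minimal_polynomial_def)
  then have "poly (map_poly of_rat N) x = 0"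
    using * pderiv_minimal_polynomial_nonzero[OF assms(1)]
    by (simp add: N pderiv_mult rat_eval.hom_add rat_eval.hom_mult)
  then have "P dvd N"
    by (rule minimal_polynomial_dvd[OF assms(1)])
  then obtain K where K: "N = P * K"
    by (rule dvdE)
  have "matrix_poly P A ** matrix_poly K A = 0"
  proof (rule symmetric_square_eq_0)
    show "transpose (matrix_poly P A) = matrix_poly P A"
      using assms(2) by (rule transpose_matrix_poly)
    show "matrix_poly P A ** (matrix_poly P A ** matrix_poly K A) = 0"
      using assms(4) by (simp add: N K matrix_poly_mult)
  qed
  then have "matrix_poly N A = 0"
    by (simp add: K matrix_poly_mult)
  moreover have "N \<noteq> 0" using assms(3) N by auto
  ultimately have "degree M \<le> degree N" by (intro least)
  moreover have "degree P \<noteq> 0"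
  proof
    assume "degree P = 0"
    then obtain c where "P = [:c:]" by (metis degree_eq_zeroE)
    then show False using pderiv_minimal_polynomial_nonzero[OF assms(1)] by (simp add: pderiv_pCons)
  qed
  ultimately show False
    using assms(3) by (auto simp: N degree_mult_eq)
qed

section \<open>The projection matrix with polynomial entries\<close>

text \<open>The matrix \<open>g(A)\<close> for \<open>g(x) = (M(x) - M(y)) / (x - y)\<close>, with entries in \<open>\<rat>[y]\<close>.\<close>

definition root_quotient :: "rat poly \<Rightarrow> rat^'n^'n \<Rightarrow> rat poly^'n^'n"
  where "root_quotient M A =
    matrix_poly (synthetic_div (map_poly (\<lambda>a. [:a:]) M) [:0, 1:]) (map_matrix (\<lambda>a. [:a:]) A)"

text \<open>Evaluation sends the indeterminate \<open>[:0, 1:]\<close> to \<open>y\<close> and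
  commutes with synthetic division. A single matrix over the rational polynomials thus specialises
  to every root in every field of characteristic 0.\<close>

lemma eval_root_quotient:
  fixes y :: "'a::field_char_0"
  shows "map_matrix (\<lambda>p. poly (map_poly of_rat p) y) (root_quotient M A) =
    matrix_poly (synthetic_div (map_poly of_rat M) y) (map_matrix of_rat A)"
  unfolding root_quotient_def
  by (simp add: rat_eval.map_matrix_matrix_poly rat_eval.map_poly_synthetic_div
      map_poly_map_poly map_matrix_map_matrix map_poly_pCons comp_def)

text \<open>As \<open>M\<close> vanishes at \<open>y\<close>, it factors as \<open>[:-y, 1:]\<close>
  times its quotient, so \<open>A - y\<close> times \<open>H\<close> is the value of
  \<open>M\<close> at \<open>A\<close>, which is 0.\<close>

lemma root_quotient_range:
  fixes y :: "'a::field_char_0"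
  assumes "matrix_poly M A = 0" and "poly (map_poly of_rat M) y = 0"
  defines "H \<equiv> map_matrix (\<lambda>p. poly (map_poly of_rat p) y) (root_quotient M A)"
  shows "map_matrix of_rat A *v (H *v v) = y *s (H *v v)"
proof -
  define B where "B = (map_matrix of_rat A :: 'a^_^_)"
  have "matrix_poly ([:-y, 1:] * synthetic_div (map_poly of_rat M) y) B = map_matrix of_rat (matrix_poly M A)"
    using synthetic_div_correct'[of y "map_poly of_rat M"] assms(2)
    by (simp add: B_def of_rat.map_matrix_matrix_poly)
  also have "\<dots> = 0"
    using assms(1) by (simp add: vec_eq_iff)
  finally have "(mat (-y) + B) ** H = 0"
    unfolding matrix_poly_mult by (simp add: H_def eval_root_quotient B_def)
  then have "(mat (-y) + B) *v (H *v v) = 0"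
    by (simp add: matrix_vector_mul_assoc)
  then have "mat (-y) *v (H *v v) + B *v (H *v v) = 0"
    by (simp only: matrix_vector_mult_add_rdistrib)
  then show ?thesis
    by (simp add: mat_matrix_vector_mult B_def vec_eq_iff)
qed

text \<open>On an eigenvector the matrix acts as the value of the quotient at \<open>y\<close>;
  differentiating \<open>M = [:-y, 1:] * ?S\<close> at \<open>y\<close> identifies it with the
  derivative of \<open>M\<close>.\<close>

lemma root_quotient_eigenvector:
  fixes y :: "'a::field_char_0"
  assumes "poly (map_poly of_rat M) y = 0" and "map_matrix of_rat A *v f = y *s f"
  shows "map_matrix (\<lambda>p. poly (map_poly of_rat p) y) (root_quotient M A) *v f =
    poly (map_poly of_rat (pderiv M)) y *s f"
proof -
  let ?S = "synthetic_div (map_poly of_rat M) y"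
  have "map_poly of_rat M = [:-y, 1:] * ?S"
    using synthetic_div_correct'[of y "map_poly of_rat M"] assms(1) by simp
  then have "pderiv (map_poly of_rat M) = pderiv ([:-y, 1:] * ?S)"
    by (rule arg_cong)
  then have "poly (pderiv (map_poly of_rat M)) y = poly ?S y"
    unfolding pderiv_mult by (simp add: pderiv_pCons)
  then have "poly (map_poly of_rat (pderiv M)) y = poly ?S y"
    by (simp add: pderiv_map_poly of_rat.comm_ring_1_hom_axioms)
  then show ?thesis
    by (simp add: eval_root_quotient matrix_poly_eigenvector[OF assms(2)])
qed

lemma transpose_eval_root_quotient:
  fixes y :: "'a::field_char_0"
  assumes "transpose A = A"
  shows "transpose (map_matrix (\<lambda>p. poly (map_poly of_rat p) y) (root_quotient M A)) =
    map_matrix (\<lambda>p. poly (map_poly of_rat p) y) (root_quotient M A)"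
proof -
  have "transpose (map_matrix of_rat A) = (map_matrix of_rat (transpose A) :: 'a^_^_)"
    by (simp add: transpose_def vec_eq_iff)
  then show ?thesis
    unfolding eval_root_quotient by (intro transpose_matrix_poly) (simp add: assms)
qed

text \<open>This expresses the dimension of an eigenspace through values of rational polynomials at
  \<open>y\<close>, the form in which it can be carried to conjugates.\<close>

lemma trace_eval_root_quotient:
  fixes y :: real and A :: "rat^'n^'n"
  assumes "matrix_poly M A = 0" and "poly (map_poly of_rat M) y = 0" and "transpose A = A"
  shows "poly (map_poly of_rat (trace (root_quotient M A))) y =
    poly (map_poly of_rat (pderiv M)) y * real (dim (eigenspace (map_matrix of_rat A) y))"
proof -
  let ?H = "map_matrix (\<lambda>p. poly (map_poly of_rat p) y) (root_quotient M A)"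
  have "subspace (eigenspace (map_matrix of_rat A) y)"
    by (auto simp: subspace_def eigenspace_def matrix_vector_right_distrib scaleR_add_right
        matrix_vector_mult_scaleR)
  then have "trace ?H = poly (map_poly of_rat (pderiv M)) y * real (dim (eigenspace (map_matrix of_rat A) y))"
    using root_quotient_range[OF assms(1,2)] root_quotient_eigenvector[OF assms(2)]
    by (intro trace_eq_dim transpose_eval_root_quotient assms(3))
      (auto simp: eigenspace_def scalar_mult_eq_scaleR)
  then show ?thesis
    by (simp add: trace_def rat_eval.hom_sum)
qed

section \<open>Transfer from the eigenvalue to its conjugate\<close>

theorem theorem5p1:
  fixes E :: "'n::finite set set"
    and \<alpha> :: real and \<alpha>' :: complex
    and P :: "rat poly" and m :: nat
  assumes "simple_graph E" and "connected_graph E"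
    and "\<alpha> \<notin> \<rat>"
    and "is_eigenvalue (laplacian E) \<alpha>"
    and "dim (eigenspace (laplacian E) \<alpha>) = m"
    and "is_minimal_polynomial P \<alpha>"
    and "poly (map_poly of_rat P) \<alpha>' = 0"
    and "\<alpha>' \<noteq> complex_of_real \<alpha>"
  shows "\<exists>\<beta>::real. \<alpha>' = complex_of_real \<beta>
    \<and> is_eigenvalue (laplacian E) \<beta>
    \<and> dim (eigenspace (laplacian E) \<beta>) = m
    \<and> (\<forall>(W :: 'n set) (a :: 'n \<Rightarrow> real).
          (\<forall>w\<in>W. a w \<in> \<rat>) \<and> averages_space W a (eigenspace (laplacian E) \<alpha>)
          \<longrightarrow> averages_space W a (eigenspace (laplacian E) \<beta>))"
proof -
  let ?L = "laplacian E"
  define A :: "rat^'n^'n" where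
    "A = (\<chi> i j. if i = j then of_nat (deg E i) else if {i, j} \<in> E then -1 else 0)"
  have L: "?L = map_matrix of_rat A"
    by (simp add: A_def laplacian_def vec_eq_iff)
  have sym: "transpose A = A"
    by (simp add: A_def transpose_def vec_eq_iff insert_commute)
  have symL: "transpose ?L = ?L"
    by (simp add: laplacian_def transpose_def vec_eq_iff insert_commute)
  obtain M where M: "M \<noteq> 0" "matrix_poly M A = 0"
    and least: "\<And>N. N \<noteq> 0 \<Longrightarrow> matrix_poly N A = 0 \<Longrightarrow> degree M \<le> degree N"
  proof -
    obtain p where p: "p \<noteq> 0 \<and> matrix_poly p A = 0"
      using annihilating_poly_exists by blast
    show thesis
      using ex_has_least_nat[of "\<lambda>p. p \<noteq> 0 \<and> matrix_poly p A = 0", OF p, of degree] that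
      by metis
  qed
  obtain f where f: "f \<noteq> 0" "?L *v f = \<alpha> *s f"
    using assms(4) by (auto simp: is_eigenvalue_def scalar_mult_eq_scaleR)
  have "poly (map_poly of_rat M) \<alpha> *s f = map_matrix of_rat (matrix_poly M A) *v f"
    using matrix_poly_eigenvector[OF f(2)] by (simp add: L of_rat.map_matrix_matrix_poly)
  also have "map_matrix of_rat (matrix_poly M A) = (0 :: real^'n^'n)"
    using M(2) by (simp add: vec_eq_iff)
  finally have M\<alpha>: "poly (map_poly of_rat M) \<alpha> = 0"
    using f(1) by (auto simp: vec_eq_iff)
  \<comment> \<open>So far \<open>\<alpha>'\<close> is only complex. The transfer is made over the
    complex numbers to show that it is real, and repeated over the reals for
    \<open>\<beta>\<close>.\<close>
  have min': "is_minimal_polynomial P \<alpha>'"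
    using assms(6,7) by (rule minimal_polynomial_conjugate)
  define D where "D = pderiv M"
  define R where "R = root_quotient M A"
  have D\<alpha>: "poly (map_poly of_rat D) \<alpha> \<noteq> 0"
    unfolding D_def using assms(6) sym M least M\<alpha> by (rule pderiv_annihilator_nonzero)
  have "m \<noteq> 0"
  proof
    assume "m = 0"
    then have "eigenspace ?L \<alpha> \<subseteq> {0}" using assms(5) by simp
    moreover have "f \<in> eigenspace ?L \<alpha>"
      using f(2) by (simp add: eigenspace_def scalar_mult_eq_scaleR)
    ultimately show False using f(1) by auto
  qed
  \<comment> \<open>At a real root of \<open>M\<close>, where \<open>D\<close> does not vanish,
    \<open>T\<close> vanishes exactly when the eigenspace has dimension \<open>m\<close>.\<close>
  define T where "T = trace R - D * of_nat m"
  have "poly (map_poly of_rat (trace R)) \<alpha> = poly (map_poly of_rat D) \<alpha> * real m"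
    using trace_eval_root_quotient[OF M(2) M\<alpha> sym] assms(5) by (simp add: R_def D_def flip: L)
  moreover have "trace R = T + D * of_nat m" by (simp add: T_def)
  ultimately have "poly (map_poly of_rat T) \<alpha> = 0"
    by (simp add: rat_eval.hom_add rat_eval.hom_mult rat_eval.hom_of_nat)
  note conj = minimal_polynomial_eval_0_iff[OF assms(6)] minimal_polynomial_eval_0_iff[OF min']
  have "poly (map_poly of_rat T) \<alpha>' = 0" "poly (map_poly of_rat M) \<alpha>' = 0"
    "poly (map_poly of_rat D) \<alpha>' \<noteq> 0"
    using \<open>poly (map_poly of_rat T) \<alpha> = 0\<close> M\<alpha> D\<alpha> by (simp_all add: conj)
  have "poly (map_poly of_rat (trace R)) \<alpha>' = poly (map_poly of_rat D) \<alpha>' * of_nat m"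
    unfolding \<open>trace R = T + D * of_nat m\<close> rat_eval.hom_add rat_eval.hom_mult rat_eval.hom_of_nat
    using \<open>poly (map_poly of_rat T) \<alpha>' = 0\<close> by simp
  then have "poly (map_poly of_rat (trace R)) \<alpha>' \<noteq> 0"
    using \<open>m \<noteq> 0\<close> \<open>poly (map_poly of_rat D) \<alpha>' \<noteq> 0\<close> by simp
  then obtain j where j: "poly (map_poly of_rat (R $ j $ j)) \<alpha>' \<noteq> 0"
    unfolding trace_def rat_eval.hom_sum by (metis (no_types, lifting) sum.neutral)
  \<comment> \<open>A nonzero trace forces a nonzero diagonal entry, so column \<open>j\<close> is a
    nonzero complex eigenvector.\<close>
  define v where "v = map_matrix (\<lambda>p. poly (map_poly of_rat p) \<alpha>') R *v axis j 1"
  have "v $ j \<noteq> 0"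
    using j by (simp add: v_def matrix_vector_mult_def axis_def if_distrib cong: if_cong)
  then have "v \<noteq> 0" by auto
  moreover have "map_matrix of_real ?L = (map_matrix of_rat A :: complex^'n^'n)"
    by (simp add: L map_matrix_map_matrix of_real_of_rat)
  then have "map_matrix of_real ?L *v v = \<alpha>' *s v"
    using root_quotient_range[OF M(2) \<open>poly (map_poly of_rat M) \<alpha>' = 0\<close>] by (simp add: v_def R_def)
  ultimately have "\<alpha>' \<in> \<real>"
    using symmetric_eigenvalue_real[OF symL] by blast
  then obtain \<beta> where \<beta>: "\<alpha>' = complex_of_real \<beta>" by (rule Reals_cases)
  have "map_poly of_rat Q = map_poly complex_of_real (map_poly of_rat Q)" for Q
    by (simp add: map_poly_map_poly comp_def of_real_of_rat)
  then have "poly (map_poly of_rat P) (complex_of_real \<beta>) = complex_of_real (poly (map_poly of_rat P) \<beta>)"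
    by (simp only: of_real.poly_map_poly)
  then have min\<beta>: "is_minimal_polynomial P \<beta>"
    using assms(7) \<beta> by (intro minimal_polynomial_conjugate[OF assms(6)]) auto
  note conj\<beta> = minimal_polynomial_eval_0_iff[OF assms(6)] minimal_polynomial_eval_0_iff[OF min\<beta>]
  have M\<beta>: "poly (map_poly of_rat M) \<beta> = 0" and D\<beta>: "poly (map_poly of_rat D) \<beta> \<noteq> 0"
    and T\<beta>: "poly (map_poly of_rat T) \<beta> = 0"
    using \<open>poly (map_poly of_rat T) \<alpha> = 0\<close> M\<alpha> D\<alpha> by (simp_all add: conj\<beta>)
  have "poly (map_poly of_rat (trace R)) \<beta> = poly (map_poly of_rat D) \<beta> * real m"
    unfolding \<open>trace R = T + D * of_nat m\<close> rat_eval.hom_add rat_eval.hom_mult rat_eval.hom_of_nat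
    using T\<beta> by simp
  then have dim: "dim (eigenspace ?L \<beta>) = m"
    using trace_eval_root_quotient[OF M(2) M\<beta> sym] D\<beta> by (simp add: R_def D_def flip: L)
  then have "\<not> eigenspace ?L \<beta> \<subseteq> {0}"
    using \<open>m \<noteq> 0\<close> by (metis dim_eq_0)
  then have ev: "is_eigenvalue ?L \<beta>"
    by (auto simp: is_eigenvalue_def eigenspace_def)
  have "averages_space W a (eigenspace ?L \<beta>)"
    if W: "\<forall>w\<in>W. a w \<in> \<rat>" "averages_space W a (eigenspace ?L \<alpha>)" for W and a :: "'n \<Rightarrow> real"
  proof -
    \<comment> \<open>The averaging defect as one linear functional on all vertices. Its
      coefficients are rational because the weights are, with 0 in place of \<open>a\<close> outside
      \<open>W\<close>.\<close>
    define c where "c w = (if w \<in> W then a w else 0) - 1 / real CARD('n)" for w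
    have "\<exists>r. c w = of_rat r" for w
    proof -
      have "c w \<in> \<rat>"
        using W(1) by (auto simp: c_def)
      then show ?thesis by (auto elim: Rats_cases)
    qed
    then obtain q where q: "\<And>w. c w = of_rat (q w)"
      by metis
    have avg: "averages W a g \<longleftrightarrow> (\<Sum>w\<in>UNIV. c w * g $ w) = 0" for g
    proof -
      have "(\<Sum>w\<in>UNIV. (if w \<in> W then a w else 0) * g $ w) = (\<Sum>w\<in>W. a w * g $ w)"
        by (simp add: if_distrib[where f = "\<lambda>x. x * _"] sum.If_cases cong: if_cong)
      then show ?thesis
        by (auto simp: averages_def c_def left_diff_distrib sum_subtractf sum_distrib_left)
    qed
    \<comment> \<open>The defect of column \<open>k\<close>, as a rational polynomial in the
      root.\<close>
    define Q where "Q k = (\<Sum>w\<in>UNIV. [:q w:] * R $ w $ k)" for k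
    have Q: "poly (map_poly of_rat (Q k)) y = (\<Sum>w\<in>UNIV. c w * poly (map_poly of_rat (R $ w $ k)) y)"
      for k and y :: real
      unfolding Q_def rat_eval.hom_sum rat_eval.hom_mult by (simp add: map_poly_pCons q)
    have "poly (map_poly of_rat (Q k)) \<alpha> = 0" for k
    proof -
      let ?g = "map_matrix (\<lambda>p. poly (map_poly of_rat p) \<alpha>) R *v axis k 1"
      have "?g \<in> eigenspace ?L \<alpha>"
        using root_quotient_range[OF M(2) M\<alpha>, of "axis k 1"]
        by (simp add: eigenspace_def L R_def scalar_mult_eq_scaleR)
      then have "(\<Sum>w\<in>UNIV. c w * ?g $ w) = 0"
        using W(2) avg by (auto simp: averages_space_def)
      then show ?thesis
        by (simp add: Q matrix_vector_mult_basis column_def)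
    qed
    then have Q\<beta>: "(\<Sum>w\<in>UNIV. c w * poly (map_poly of_rat (R $ w $ k)) \<beta>) = 0" for k
      unfolding Q[symmetric] by (simp add: conj\<beta>)
    show ?thesis
      unfolding averages_space_def
    proof
      fix g assume "g \<in> eigenspace ?L \<beta>"
      then have "map_matrix (\<lambda>p. poly (map_poly of_rat p) \<beta>) R *v g = poly (map_poly of_rat D) \<beta> *s g"
        unfolding R_def D_def using M\<beta>
        by (intro root_quotient_eigenvector) (simp_all add: eigenspace_def L scalar_mult_eq_scaleR)
      \<comment> \<open>Up to the nonzero factor from \<open>D\<close>, every eigenvector
        \<open>g\<close> is the combination of the columns with its own entries as coefficients, so
        its defect vanishes with theirs.\<close>
      then have g: "poly (map_poly of_rat D) \<beta> * g $ w =
          (\<Sum>k\<in>UNIV. poly (map_poly of_rat (R $ w $ k)) \<beta> * g $ k)" for w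
        by (simp add: vec_eq_iff matrix_vector_mult_def)
      have "poly (map_poly of_rat D) \<beta> * (\<Sum>w\<in>UNIV. c w * g $ w) =
          (\<Sum>w\<in>UNIV. c w * (poly (map_poly of_rat D) \<beta> * g $ w))"
        by (simp add: sum_distrib_left mult.left_commute)
      also have "\<dots> = (\<Sum>k\<in>UNIV. (\<Sum>w\<in>UNIV. c w * poly (map_poly of_rat (R $ w $ k)) \<beta>) * g $ k)"
        unfolding g sum_distrib_left sum_distrib_right by (subst sum.swap) (simp add: mult.assoc)
      also have "\<dots> = 0" by (simp add: Q\<beta>)
      finally show "averages W a g" using D\<beta> by (simp add: avg)
    qed
  qed
  with \<beta> ev dim show ?thesis by blast
qed

end
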